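(* Let $Q^T\tau$ be a bipartite system of $s$ pairwise comparisons of $v$ treatments, let $G$ be the corresponding graph and let $d_i$ be the degree of vertex $i$ in $G$. Then the treatment proportions $$w_i^*=\frac{d_i}{\sum_j d_j},\qquad i=1,\ldots,v,$$ are $E$-optimal for $Q^T\tau$, with the optimal value $\Psi_{-\infty}(w^* )=\lambda_{\max}(V_Q(w^* ))=2\sum_i d_i=4s$. Moreover, if each vertex of $G$ is either a sink or a source, then $h=1_s/\sqrt{s}$ is an eigenvector of $V_Q(w^* )$ corresponding to $\lambda_{\max}(V_Q(w^* ))$.
   Context: A system of $s$ pairwise comparisons $Q^T\tau$ is given by a $v\times s$ matrix $Q$ every column of which represents a difference $\tau_j-\tau_i$ with $i\ne j$ (entry $1$ in row $j$, $-1$ in row $i$, zeros elsewhere), different columns corresponding to different unordered pairs $\{i,j\}$; no row of $Q$ is zero. $Q$ need not have full column rank. The corresponding directed graph $G$ has vertex set $\{1,\ldots,v\}$ and an edge $(j,i)$, directed from $j$ to $i$, for each comparison $\tau_j-\tau_i$ in the system. The degree $d_i$ is the number of edges incident with $i$ (regardless of direction). A vertex is a sink if all edges incident with it are directed towards it, and a source if all edges incident with it are directed from it. The system is bipartite if $G$ (disregarding directions) is a bipartite graph. A design is a vector $w$ with $w_i\in[0,1]$, $\sum_iw_i=1$; it is feasible if and only if $w_i>0$ for all $i$ (written $w>0$). $V_Q(w)=Q^T\mathrm{diag}(w)^{-1}Q$, $\Psi_{-\infty}(w)=\lambda_{\max}(V_Q(w))$, and a design is $E$-optimal if it minimizes $\Psi_{-\infty}(w)$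 over all designs $w>0$. *)

theory Defs
  imports "HOL-Analysis.Analysis" "Graph_Theory.Digraph"
begin

text \<open>
  The \<open>v\<close> treatments are the elements of the finite index type \<open>'v\<close> and the \<open>s\<close> comparisons
  those of \<open>'s\<close>; a \<open>v \<times> s\<close> matrix is thus of type \<open>real^'s^'v\<close>.
\<close>

text \<open>The coefficient vector of \<open>\<tau>\<^sub>j - \<tau>\<^sub>i\<close>.\<close>

definition is_comparison :: "real^'v \<Rightarrow> 'v \<Rightarrow> 'v \<Rightarrow> bool" where
  "is_comparison c j i \<longleftrightarrow> i \<noteq> j \<and> c = axis j 1 - axis i 1"

definition comparison_system :: "real^'s^'v \<Rightarrow> bool" where
  "comparison_system Q \<longleftrightarrow>
     (\<forall>k. \<exists>j i. is_comparison (column k Q) j i) \<and>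
     (\<forall>k l j i j' i'. is_comparison (column k Q) j i \<and> is_comparison (column l Q) j' i' \<and>
        {i, j} = {i', j'} \<longrightarrow> k = l) \<and>
     (\<forall>i. row i Q \<noteq> 0)"

definition comparison_graph :: "real^'s^'v \<Rightarrow> ('v, 'v \<times> 'v) pre_digraph" where
  "comparison_graph Q =
     \<lparr> verts = UNIV, arcs = {(j, i). \<exists>k. is_comparison (column k Q) j i}, tail = fst, head = snd \<rparr>"

definition incident_arcs :: "('a, 'b) pre_digraph \<Rightarrow> 'a \<Rightarrow> 'b set" where
  "incident_arcs G i = in_arcs G i \<union> out_arcs G i"

definition vertex_degree :: "('a, 'b) pre_digraph \<Rightarrow> 'a \<Rightarrow> nat" where
  "vertex_degree G i = card (incident_arcs G i)"

definition is_sink :: "('a, 'b) pre_digraph \<Rightarrow> 'a \<Rightarrow> bool" where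
  "is_sink G i \<longleftrightarrow> (\<forall>e \<in> incident_arcs G i. head G e = i)"

definition is_source :: "('a, 'b) pre_digraph \<Rightarrow> 'a \<Rightarrow> bool" where
  "is_source G i \<longleftrightarrow> (\<forall>e \<in> incident_arcs G i. tail G e = i)"

definition bipartite :: "('a, 'b) pre_digraph \<Rightarrow> bool" where
  "bipartite G \<longleftrightarrow>
     (\<exists>A B. A \<union> B = verts G \<and> A \<inter> B = {} \<and>
        (\<forall>e \<in> arcs G. tail G e \<in> A \<and> head G e \<in> B \<or> tail G e \<in> B \<and> head G e \<in> A))"

definition design :: "real^'v \<Rightarrow> bool" where
  "design w \<longleftrightarrow> (\<forall>i. w $ i \<in> {0..1}) \<and> (\<Sum>i\<in>UNIV. w $ i) = 1"

definition feasible :: "real^'v \<Rightarrow> bool" where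
  "feasible w \<longleftrightarrow> (\<forall>i. w $ i > 0)"

definition diag :: "real^'v \<Rightarrow> real^'v^'v" where
  "diag w = (\<chi> i j. if i = j then w $ i else 0)"

definition V_matrix :: "real^'s^'v \<Rightarrow> real^'v \<Rightarrow> real^'s^'s" where
  "V_matrix Q w = transpose Q ** matrix_inv (diag w) ** Q"

definition eigenvector :: "real^'n^'n \<Rightarrow> real^'n \<Rightarrow> real \<Rightarrow> bool" where
  "eigenvector A x l \<longleftrightarrow> x \<noteq> 0 \<and> A *v x = l *\<^sub>R x"

text \<open>
  The largest real eigenvalue. It is applied to symmetric matrices only, which have
  finitely many eigenvalues, all real, and at least one.
\<close>

definition lambda_max :: "real^'n^'n \<Rightarrow> real" where
  "lambda_max A = Max {l. \<exists>x. eigenvector A x l}"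

text \<open>The criterion \<open>\<Psi>\<close> with index \<open>-\<infinity>\<close>.\<close>

definition Psi_minf :: "real^'s^'v \<Rightarrow> real^'v \<Rightarrow> real" where
  "Psi_minf Q w = lambda_max (V_matrix Q w)"

definition E_optimal :: "real^'s^'v \<Rightarrow> real^'v \<Rightarrow> bool" where
  "E_optimal Q w \<longleftrightarrow> design w \<and> feasible w \<and>
     (\<forall>u. design u \<and> feasible u \<longrightarrow> Psi_minf Q w \<le> Psi_minf Q u)"

end

theory Submission
  imports Defs
begin

text \<open>
  Everything is read off the quadratic form \<open>x \<bullet> V(u) x = (\<Sum>i. (Q x)\<^sub>i\<^sup>2 / u\<^sub>i)\<close>.
  The \<open>i\<close>-th row of \<open>Q\<close> has \<open>d\<^sub>i\<close> nonzero entries, so Cauchy--Schwarz gives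
  \<open>(Q x)\<^sub>i\<^sup>2 \<le> d\<^sub>i (\<Sum>k. Q\<^sub>i\<^sub>k\<^sup>2 x\<^sub>k\<^sup>2)\<close>, and at \<open>u = w*\<close> the form is at most \<open>4s \<bar>x\<bar>\<^sup>2\<close>.
  Conversely, encode a bipartition by a sign vector \<open>e\<close> and let \<open>h\<close> be half of \<open>Q\<^sup>T e\<close>, which has
  entries \<open>\<plusminus>1\<close>. Then \<open>(Q h)\<^sub>i = e\<^sub>i d\<^sub>i\<close>, so Cauchy--Schwarz against \<open>u\<close> gives
  \<open>h \<bullet> V(u) h = (\<Sum>i. d\<^sub>i\<^sup>2 / u\<^sub>i) \<ge> (\<Sum>i. d\<^sub>i)\<^sup>2 = 4s \<bar>h\<bar>\<^sup>2\<close> for every design \<open>u\<close>,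
  and \<open>h\<close> is an eigenvector of \<open>V(w*)\<close>. If all vertices are sinks or sources, they form a
  bipartition for which \<open>h\<close> is the all-ones vector.
\<close>

section \<open>Eigenvalues and Rayleigh quotients of symmetric matrices\<close>

text \<open>Eigenvectors for distinct eigenvalues are orthogonal, and pairwise orthogonal sets are
  finite. This makes the \<open>Max\<close> in \<open>lambda_max\<close> meaningful.\<close>

lemma finite_eigenvalues_symmetric:
  fixes A :: "real^'n^'n"
  assumes "transpose A = A"
  shows "finite {l. \<exists>x. eigenvector A x l}"
proof -
  let ?L = "{l. \<exists>x. eigenvector A x l}"
  define f where "f l = (SOME x. eigenvector A x l)" for l
  have f: "eigenvector A (f l) l" if "l \<in> ?L" for l
    using that unfolding f_def by (auto intro: someI_ex)
  have orth: "f l \<bullet> f m = 0" if "l \<in> ?L" "m \<in> ?L" "l \<noteq> m" for l m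
  proof -
    have "(A *v f l) \<bullet> f m = f l \<bullet> (A *v f m)"
      by (metis assms dot_lmul_matrix transpose_matrix_vector)
    then have "l * (f l \<bullet> f m) = m * (f l \<bullet> f m)"
      using f[OF that(1)] f[OF that(2)] by (simp add: eigenvector_def)
    then show ?thesis using that(3) by simp
  qed
  have "inj_on f ?L"
  proof (rule inj_onI)
    fix l m assume lm: "l \<in> ?L" "m \<in> ?L" "f l = f m"
    then have "f l \<bullet> f m \<noteq> 0" using f[OF lm(1)] by (simp add: eigenvector_def)
    then show "l = m" using orth lm by blast
  qed
  moreover have "finite (f ` ?L)"
    by (rule pairwise_orthogonal_imp_finite)
      (use orth in \<open>force simp: pairwise_def orthogonal_def\<close>)
  ultimately show ?thesis using finite_imageD by blast
qed

text \<open>Otherwise a small step from \<open>x\<close> in the direction of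
  \<open>- (B *v x)\<close> would make the form negative.\<close>

lemma psd_form_zero_imp_kernel:
  fixes B :: "real^'n^'n"
  assumes sym: "transpose B = B" and psd: "\<And>x. 0 \<le> x \<bullet> (B *v x)"
    and zero: "x \<bullet> (B *v x) = 0"
  shows "B *v x = 0"
proof (rule ccontr)
  assume nz: "B *v x \<noteq> 0"
  define y where "y = B *v x"
  define a where "a = y \<bullet> y"
  define b where "b = y \<bullet> (B *v y)"
  have a: "a > 0" using nz by (simp add: a_def y_def)
  have b: "b \<ge> 0" using psd by (simp add: b_def)
  have xy: "x \<bullet> (B *v y) = a"
    by (metis a_def y_def sym dot_lmul_matrix transpose_matrix_vector)
  \<comment> \<open>The minimizer of \<open>2 * t * a + t^2 * b\<close> is \<open>- a / b\<close>;
    the shifted denominator also covers \<open>b = 0\<close> and keeps the value negative.\<close>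
  define t where "t = - a / (b + 1)"
  have "0 \<le> (x + t *\<^sub>R y) \<bullet> (B *v (x + t *\<^sub>R y))" by (rule psd)
  also have "\<dots> = 2 * t * a + t\<^sup>2 * b"
    using zero xy
    by (simp add: matrix_vector_right_distrib matrix_vector_mult_scaleR inner_add_left
        inner_add_right y_def[symmetric] a_def[symmetric] b_def[symmetric] power2_eq_square)
      (simp add: a_def inner_commute algebra_simps)
  also have "\<dots> = - (a\<^sup>2 * (b + 2)) / (b + 1)\<^sup>2"
    using b unfolding t_def by (simp add: divide_simps) (simp add: algebra_simps power2_eq_square)
  also have "\<dots> < 0" using a b by (simp add: divide_neg_pos)
  finally show False by simp
qed

text \<open>
  A maximizer \<open>y\<close> of the form on the unit sphere, with value \<open>l\<close>, annihilates the form of the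
  positive semidefinite matrix \<open>l I - A\<close>, hence lies in its kernel.
\<close>

lemma exists_eigenvalue_ge_rayleigh:
  fixes A :: "real^'n^'n"
  assumes sym: "transpose A = A"
  obtains l y where "eigenvector A y l" "\<And>x. x \<bullet> (A *v x) \<le> l * (x \<bullet> x)"
proof -
  have "continuous_on (sphere 0 1) (\<lambda>x. x \<bullet> (A *v x))"
    by (intro continuous_intros matrix_vector_mult_linear_continuous_on)
  moreover have "sphere (0::real^'n) 1 \<noteq> {}" by simp
  ultimately obtain y where y: "norm y = 1"
    and ymax: "\<And>x. norm x = 1 \<Longrightarrow> x \<bullet> (A *v x) \<le> y \<bullet> (A *v y)"
    using continuous_attains_sup[OF compact_sphere, of "0::real^'n" 1 "\<lambda>x. x \<bullet> (A *v x)"]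
    by (auto simp: dist_norm)
  define l where "l = y \<bullet> (A *v y)"
  have bound: "x \<bullet> (A *v x) \<le> l * (x \<bullet> x)" for x
  proof (cases "x = 0")
    case False
    define z where "z = (1 / norm x) *\<^sub>R x"
    have "norm z = 1" using False by (simp add: z_def)
    then have "z \<bullet> (A *v z) \<le> l" using ymax l_def by simp
    moreover have "x \<bullet> (A *v x) = (norm x)\<^sup>2 * (z \<bullet> (A *v z))"
      using False by (simp add: z_def matrix_vector_mult_scaleR power2_eq_square)
    ultimately show ?thesis
      by (simp add: dot_square_norm mult.commute mult_right_mono)
  qed simp
  define B where "B = l *\<^sub>R mat 1 - A"
  have Bx: "B *v x = l *\<^sub>R x - A *v x" for x
    by (simp add: B_def matrix_vector_mult_diff_rdistrib scaleR_matrix_vector_assoc[symmetric])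
  have "transpose B = B"
    using sym by (simp add: B_def transpose_def mat_def vec_eq_iff)
  moreover have "0 \<le> x \<bullet> (B *v x)" for x
    using bound[of x] by (simp add: Bx inner_diff_right)
  moreover have "y \<bullet> (B *v y) = 0"
    using y by (simp add: Bx inner_diff_right l_def dot_square_norm)
  ultimately have "B *v y = 0" by (rule psd_form_zero_imp_kernel)
  then have "eigenvector A y l" using y by (auto simp: eigenvector_def Bx)
  then show thesis using bound that by blast
qed

text \<open>Some eigenvalue dominates all Rayleigh quotients, so any nonzero test vector,
  eigenvector or not, yields a lower bound.\<close>

lemma lambda_max_ge:
  fixes A :: "real^'n^'n"
  assumes "transpose A = A" "x \<noteq> 0" "c * (x \<bullet> x) \<le> x \<bullet> (A *v x)"
  shows "c \<le> lambda_max A"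
proof -
  obtain l y where l: "eigenvector A y l" "\<And>x. x \<bullet> (A *v x) \<le> l * (x \<bullet> x)"
    using exists_eigenvalue_ge_rayleigh[OF assms(1)] by blast
  have "c * (x \<bullet> x) \<le> l * (x \<bullet> x)" using assms(3) l(2)[of x] by simp
  then have "c \<le> l" using assms(2) by simp
  also have "l \<le> lambda_max A"
    unfolding lambda_max_def using l(1)
    by (intro Max_ge finite_eigenvalues_symmetric assms(1)) auto
  finally show ?thesis .
qed

lemma lambda_max_eqI:
  fixes A :: "real^'n^'n"
  assumes "transpose A = A" "eigenvector A y c" "\<And>x. x \<bullet> (A *v x) \<le> c * (x \<bullet> x)"
  shows "lambda_max A = c"
  unfolding lambda_max_def
proof (rule Max_eqI)
  fix l assume "l \<in> {l. \<exists>x. eigenvector A x l}"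
  then obtain x where "eigenvector A x l" by auto
  then show "l \<le> c" using assms(3)[of x] by (simp add: eigenvector_def)
qed (use assms finite_eigenvalues_symmetric in auto)

section \<open>The matrix V and its quadratic form\<close>

lemma matrix_inv_unique:
  fixes A :: "'a::semiring_1^'n^'m"
  assumes "A ** B = mat 1" "B ** A = mat 1"
  shows "matrix_inv A = B"
proof -
  have "A ** matrix_inv A = mat 1 \<and> matrix_inv A ** A = mat 1"
    unfolding matrix_inv_def by (rule someI[of _ B]) (simp add: assms)
  then show ?thesis
    by (metis assms(2) matrix_mul_assoc matrix_mul_lid matrix_mul_rid)
qed

lemma matrix_inv_diag:
  assumes "feasible u"
  shows "matrix_inv (diag u) = diag (\<chi> i. inverse (u $ i))"
proof (rule matrix_inv_unique)
  have u: "u $ i \<noteq> 0" for i using assms by (metis feasible_def less_irrefl)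
  have *: "(\<Sum>k\<in>UNIV. (if i = k then a i else 0) * (if k = j then b k else 0)) =
      (if i = j then a i * b j else 0)" for i j and a b :: "'a \<Rightarrow> real"
    by (simp add: if_distrib[of "\<lambda>x. x * _"] cong: if_cong)
  show "diag u ** diag (\<chi> i. inverse (u $ i)) = mat 1"
    "diag (\<chi> i. inverse (u $ i)) ** diag u = mat 1"
    using u by (simp_all add: vec_eq_iff matrix_matrix_mult_def diag_def mat_def *)
qed

lemma V_matrix_apply:
  fixes Q :: "real^'s^'v"
  assumes "feasible u"
  shows "V_matrix Q u *v x = transpose Q *v (\<chi> i. (Q *v x) $ i / u $ i)"
proof -
  have "diag (\<chi> i. inverse (u $ i)) *v z = (\<chi> i. z $ i / u $ i)" for z
    by (simp add: vec_eq_iff matrix_vector_mult_def diag_def divide_inverse_commute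
        if_distrib[of "\<lambda>x. x * _"] cong: if_cong)
  then show ?thesis
    by (simp add: V_matrix_def matrix_inv_diag[OF assms] matrix_vector_mul_assoc[symmetric])
qed

lemma V_matrix_form:
  fixes Q :: "real^'s^'v"
  assumes "feasible u"
  shows "x \<bullet> (V_matrix Q u *v x) = (\<Sum>i\<in>UNIV. ((Q *v x) $ i)\<^sup>2 / u $ i)"
proof -
  have "x \<bullet> (V_matrix Q u *v x) = (Q *v x) \<bullet> (\<chi> i. (Q *v x) $ i / u $ i)"
    unfolding V_matrix_apply[OF assms]
    by (metis dot_lmul_matrix transpose_transpose transpose_matrix_vector)
  then show ?thesis by (simp add: inner_vec_def power2_eq_square)
qed

lemma transpose_V_matrix:
  fixes Q :: "real^'s^'v"
  assumes "feasible u"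
  shows "transpose (V_matrix Q u) = V_matrix Q u"
proof -
  have "transpose (diag z) = diag z" for z :: "real^'v"
    by (auto simp: transpose_def diag_def vec_eq_iff)
  then show ?thesis
    by (simp add: V_matrix_def matrix_inv_diag[OF assms] matrix_transpose_mul matrix_mul_assoc)
qed

section \<open>Comparison systems, degrees and the design \<open>w\<close>\<close>

lemma is_comparison_iff:
  fixes a b i j :: "'v::finite"
  assumes "a \<noteq> b"
  shows "is_comparison (axis a 1 - axis b 1 :: real^'v) j i \<longleftrightarrow> j = a \<and> i = b"
proof
  assume "is_comparison (axis a 1 - axis b 1 :: real^'v) j i"
  then have "i \<noteq> j" and
    *: "(axis a 1 - axis b 1 :: real^'v) $ m = (axis j 1 - axis i 1) $ m" for m
    by (auto simp: is_comparison_def)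
  then show "j = a \<and> i = b"
    using *[of a] *[of b] assms by (auto simp: axis_def split: if_splits)
qed (use assms in \<open>auto simp: is_comparison_def\<close>)

text \<open>The arc of comparison \<open>k\<close> runs from \<open>p k\<close>, where column
  \<open>k\<close> is 1, to \<open>n k\<close>, where it is -1. Injectivity allows arcs to be
  counted by comparisons.\<close>

locale comparisons =
  fixes Q :: "real^'s^'v" and p n :: "'s::finite \<Rightarrow> 'v::finite"
  assumes entry: "\<And>i k. Q $ i $ k = of_bool (i = p k) - of_bool (i = n k)"
    and p_neq_n: "\<And>k. p k \<noteq> n k"
    and inj: "inj (\<lambda>k. (p k, n k))"
    and row_nz: "\<And>i. \<exists>k. Q $ i $ k \<noteq> 0"
begin

lemma arcs_eq: "arcs (comparison_graph Q) = range (\<lambda>k. (p k, n k))"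
proof -
  have "column k Q = axis (p k) 1 - axis (n k) 1" for k
    by (auto simp: vec_eq_iff column_def entry axis_def)
  then show ?thesis
    by (auto simp: comparison_graph_def is_comparison_iff p_neq_n)
qed

lemma incident_arcs_eq:
  "incident_arcs (comparison_graph Q) i = (\<lambda>k. (p k, n k)) ` {k. p k = i \<or> n k = i}"
  using arcs_eq
  by (auto simp: incident_arcs_def in_arcs_def out_arcs_def comparison_graph_def)

lemma entry_sq: "(Q $ i $ k)\<^sup>2 = of_bool (i = p k) + of_bool (i = n k)"
  using p_neq_n[of k] by (auto simp: entry)

lemma degree_eq: "real (vertex_degree (comparison_graph Q) i) = (\<Sum>k\<in>UNIV. (Q $ i $ k)\<^sup>2)"
proof -
  have "vertex_degree (comparison_graph Q) i = card {k. p k = i \<or> n k = i}"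
    unfolding vertex_degree_def incident_arcs_eq
    by (rule card_image) (rule inj_on_subset[OF inj], simp)
  also have "real \<dots> = (\<Sum>k\<in>UNIV. of_bool (p k = i \<or> n k = i))"
    by (simp del: of_bool_or_iff)
  also have "\<dots> = (\<Sum>k\<in>UNIV. (Q $ i $ k)\<^sup>2)"
    using p_neq_n by (intro sum.cong) (auto simp: entry_sq)
  finally show ?thesis .
qed

definition d :: "'v \<Rightarrow> real" where "d i = (\<Sum>k\<in>UNIV. (Q $ i $ k)\<^sup>2)"

lemma d_pos: "d i > 0"
  unfolding d_def by (metis finite_class.finite_UNIV UNIV_I row_nz sum_pos2 zero_le_power2 zero_less_power2)

lemma sum_entry_sq: "(\<Sum>i\<in>UNIV. (Q $ i $ k)\<^sup>2) = 2"
  by (simp add: entry_sq sum.distrib)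

text \<open>Handshake count: every column has exactly two nonzero entries.\<close>

lemma sum_d: "(\<Sum>i\<in>UNIV. d i) = 2 * real CARD('s)"
  unfolding d_def by (subst sum.swap) (simp add: sum_entry_sq)

lemma transpose_apply: "(transpose Q *v e) $ k = e $ p k - e $ n k"
  by (simp add: matrix_vector_mult_def transpose_def entry left_diff_distrib sum_subtractf)

definition w :: "real^'v" where "w = (\<chi> i. d i / (\<Sum>j\<in>UNIV. d j))"

lemma w_component: "w $ i = d i / (2 * real CARD('s))"
  by (simp add: w_def sum_d)

lemma feasible_w: "feasible w"
  by (simp add: feasible_def w_component d_pos)

lemma design_w: "design w"
proof -
  have "(\<Sum>i\<in>UNIV. w $ i) = 1"
    by (simp add: w_component sum_divide_distrib[symmetric] sum_d)
  moreover have "w $ i \<ge> 0" for i using feasible_w by (simp add: feasible_def less_imp_le)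
  ultimately show ?thesis
    unfolding design_def by (metis UNIV_I atLeastAtMost_iff finite_class.finite_UNIV member_le_sum)
qed

lemma form_w_le: "x \<bullet> (V_matrix Q w *v x) \<le> 4 * real CARD('s) * (x \<bullet> x)"
proof -
  have row: "((Q *v x) $ i)\<^sup>2 / w $ i \<le> 2 * real CARD('s) * (\<Sum>k\<in>UNIV. (Q $ i $ k)\<^sup>2 * (x $ k)\<^sup>2)" for i
  proof -
    \<comment> \<open>Entries 0, 1 and -1 equal their cubes; the extra factors restrict the second
      Cauchy-Schwarz sum to the support of row \<open>i\<close>.\<close>
    have "(Q *v x) $ i = (\<Sum>k\<in>UNIV. Q $ i $ k * (Q $ i $ k * x $ k * Q $ i $ k))"
      unfolding matrix_vector_mult_def vec_lambda_beta
      by (intro sum.cong) (use p_neq_n in \<open>auto simp: entry\<close>)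
    also have "\<dots>\<^sup>2 \<le> d i * (\<Sum>k\<in>UNIV. (Q $ i $ k * x $ k * Q $ i $ k)\<^sup>2)"
      unfolding d_def by (rule Cauchy_Schwarz_ineq_sum)
    also have "(\<Sum>k\<in>UNIV. (Q $ i $ k * x $ k * Q $ i $ k)\<^sup>2) = (\<Sum>k\<in>UNIV. (Q $ i $ k)\<^sup>2 * (x $ k)\<^sup>2)"
      by (intro sum.cong) (use p_neq_n in \<open>auto simp: entry\<close>)
    finally show ?thesis
      using d_pos[of i] by (simp add: w_component field_simps mult_left_mono)
  qed
  have "x \<bullet> (V_matrix Q w *v x) \<le>
      (\<Sum>i\<in>UNIV. 2 * real CARD('s) * (\<Sum>k\<in>UNIV. (Q $ i $ k)\<^sup>2 * (x $ k)\<^sup>2))"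
    unfolding V_matrix_form[OF feasible_w] by (intro sum_mono row)
  also have "\<dots> = 2 * real CARD('s) * (\<Sum>k\<in>UNIV. \<Sum>i\<in>UNIV. (Q $ i $ k)\<^sup>2 * (x $ k)\<^sup>2)"
    by (subst sum.swap) (simp add: sum_distrib_left)
  also have "\<dots> = 4 * real CARD('s) * (x \<bullet> x)"
    by (simp add: sum_distrib_right[symmetric] sum_entry_sq inner_vec_def
        sum_distrib_left power2_eq_square[of "x $ _"] mult.assoc)
  finally show ?thesis .
qed

section \<open>Extremal vectors from sign vectors\<close>

text \<open>When \<open>e\<close> changes sign along every arc, this is half of
  \<open>transpose Q *v e\<close>.\<close>

definition h :: "real^'v \<Rightarrow> real^'s" where "h e = (\<chi> k. e $ p k)"

context
  fixes e :: "real^'v"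
  assumes sign: "\<And>i. e $ i = 1 \<or> e $ i = - 1" and alt: "\<And>k. e $ n k = - e $ p k"
begin

lemma sq_e: "(e $ i)\<^sup>2 = 1"
  using sign[of i] by auto

text \<open>All nonzero terms of row \<open>i\<close> equal \<open>e $ i\<close>: at a head, the
  entry -1 and the sign change along the arc cancel. Nothing is lost to cancellation between
  terms.\<close>

lemma Q_h: "(Q *v h e) $ i = e $ i * d i"
  unfolding matrix_vector_mult_def vec_lambda_beta d_def sum_distrib_left
proof (intro sum.cong refl)
  show "Q $ i $ k * h e $ k = e $ i * (Q $ i $ k)\<^sup>2" for k
    using p_neq_n[of k] alt[of k] by (auto simp: entry entry_sq h_def)
qed

lemma h_norm: "h e \<bullet> h e = real CARD('s)"
  by (simp add: inner_vec_def h_def power2_eq_square[symmetric] sq_e)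

lemma h_nz: "h e \<noteq> 0"
  using h_norm by auto

lemma eigenvector_w: "eigenvector (V_matrix Q w) (h e) (4 * real CARD('s))"
proof -
  \<comment> \<open>Weights proportional to the degrees cancel \<open>d i\<close>, leaving a
    multiple of \<open>e\<close>, which \<open>transpose Q\<close> maps back to a multiple of
    \<open>h e\<close>.\<close>
  have "(\<chi> i. (Q *v h e) $ i / w $ i) = (2 * real CARD('s)) *\<^sub>R e"
    using d_pos by (auto simp: vec_eq_iff Q_h w_component field_simps less_imp_neq[symmetric])
  moreover have "transpose Q *v e = 2 *\<^sub>R h e"
    by (simp add: vec_eq_iff transpose_apply h_def alt del: transpose_matrix_vector)
  ultimately have "V_matrix Q w *v h e = (4 * real CARD('s)) *\<^sub>R h e"
    by (simp add: V_matrix_apply[OF feasible_w] matrix_vector_mult_scaleR)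
  then show ?thesis using h_nz by (simp add: eigenvector_def)
qed

lemma lambda_max_w: "lambda_max (V_matrix Q w) = 4 * real CARD('s)"
  by (rule lambda_max_eqI[OF transpose_V_matrix[OF feasible_w] eigenvector_w form_w_le])

lemma lambda_max_lower:
  assumes "design u" "feasible u"
  shows "4 * real CARD('s) \<le> lambda_max (V_matrix Q u)"
proof (rule lambda_max_ge[OF transpose_V_matrix[OF assms(2)] h_nz])
  have u: "u $ i > 0" for i using assms(2) by (simp add: feasible_def)
  \<comment> \<open>The splitting makes the first Cauchy-Schwarz factor the total weight of
    \<open>u\<close>, which is 1.\<close>
  have "(\<Sum>i\<in>UNIV. d i)\<^sup>2 = (\<Sum>i\<in>UNIV. sqrt (u $ i) * (d i / sqrt (u $ i)))\<^sup>2"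
    using u by (simp add: less_imp_neq[symmetric])
  also have "\<dots> \<le> (\<Sum>i\<in>UNIV. (sqrt (u $ i))\<^sup>2) * (\<Sum>i\<in>UNIV. (d i / sqrt (u $ i))\<^sup>2)"
    by (rule Cauchy_Schwarz_ineq_sum)
  also have "\<dots> = (\<Sum>i\<in>UNIV. ((Q *v h e) $ i)\<^sup>2 / u $ i)"
    using assms(1) u by (simp add: design_def Q_h power_mult_distrib sq_e power_divide less_imp_le)
  finally show "4 * real CARD('s) * (h e \<bullet> h e) \<le> h e \<bullet> (V_matrix Q u *v h e)"
    by (simp add: V_matrix_form[OF assms(2)] h_norm sum_d power2_eq_square)
qed

end

section \<open>Sign vectors from the graph\<close>

lemma sign_of_bipartite:
  assumes "bipartite (comparison_graph Q)"
  obtains e :: "real^'v" where "\<And>i. e $ i = 1 \<or> e $ i = - 1" "\<And>k. e $ n k = - e $ p k"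
proof -
  obtain A B where AB: "A \<inter> B = {}"
    and "\<forall>a \<in> arcs (comparison_graph Q). fst a \<in> A \<and> snd a \<in> B \<or> fst a \<in> B \<and> snd a \<in> A"
    using assms by (auto simp: bipartite_def comparison_graph_def)
  then have arc: "p k \<in> A \<and> n k \<in> B \<or> p k \<in> B \<and> n k \<in> A" for k
    by (auto simp: arcs_eq)
  define e :: "real^'v" where "e = (\<chi> i. if i \<in> A then 1 else - 1)"
  show thesis
  proof
    show "e $ i = 1 \<or> e $ i = - 1" for i by (simp add: e_def)
    show "e $ n k = - e $ p k" for k using arc[of k] AB by (auto simp: e_def)
  qed
qed

lemma sign_of_sinks_and_sources:
  assumes "\<forall>i. is_sink (comparison_graph Q) i \<or> is_source (comparison_graph Q) i"
  obtains e :: "real^'v" where "\<And>i. e $ i = 1 \<or> e $ i = - 1" "\<And>k. e $ p k = 1" "\<And>k. e $ n k = - 1"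
proof -
  \<comment> \<open>A common vertex would be the tail of one arc and the head of another, hence
    neither a sink nor a source.\<close>
  have alt: "p k \<noteq> n l" for k l
  proof
    assume eq: "p k = n l"
    have "(p k, n k) \<in> incident_arcs (comparison_graph Q) (p k)"
      "(p l, n l) \<in> incident_arcs (comparison_graph Q) (p k)"
      unfolding incident_arcs_eq using eq by (force, force)
    then show False
      using assms[rule_format, of "p k"] eq p_neq_n[of k] p_neq_n[of l]
      unfolding is_sink_def is_source_def by (force simp: comparison_graph_def)
  qed
  define e :: "real^'v" where "e = (\<chi> i. if i \<in> range p then 1 else - 1)"
  show thesis
  proof
    show "e $ i = 1 \<or> e $ i = - 1" for i by (simp add: e_def)
    show "e $ p k = 1" for k by (simp add: e_def)
    show "e $ n k = - 1" for k using alt by (auto simp: e_def dest: sym)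
  qed
qed

end

section \<open>Endpoints of a comparison system and the optimality result\<close>

lemma comparisons_of_system:
  fixes Q :: "real^'s^'v"
  assumes "comparison_system Q"
  obtains p n where "comparisons Q p n"
proof -
  have "\<forall>k. \<exists>j i. is_comparison (column k Q) j i"
    using assms by (simp add: comparison_system_def)
  then obtain p n where pn: "\<And>k. is_comparison (column k Q) (p k) (n k)"
    by metis
  have "comparisons Q p n"
  proof
    show "Q $ i $ k = of_bool (i = p k) - of_bool (i = n k)" for i k
    proof -
      have "column k Q $ i = (axis (p k) 1 - axis (n k) 1) $ i"
        using pn[of k] by (simp add: is_comparison_def)
      then show ?thesis by (simp add: column_def axis_def of_bool_def)
    qed
    show "p k \<noteq> n k" for k using pn[of k] by (auto simp: is_comparison_def)
    show "inj (\<lambda>k. (p k, n k))"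
    proof (rule injI)
      fix k l assume "(p k, n k) = (p l, n l)"
      then have "{n k, p k} = {n l, p l}" by simp
      then show "k = l" using assms pn unfolding comparison_system_def by blast
    qed
    show "\<exists>k. Q $ i $ k \<noteq> 0" for i
      using assms by (auto simp: comparison_system_def row_def vec_eq_iff)
  qed
  then show thesis by (rule that)
qed

theorem theorem3:
  fixes Q :: "real^'s^'v"
    and G :: "('v, 'v \<times> 'v) pre_digraph"
    and d :: "'v \<Rightarrow> real"
    and w :: "real^'v"
  assumes "comparison_system Q"
    and "G = comparison_graph Q"
    and "bipartite G"
    and "\<And>i. d i = real (vertex_degree G i)"
    and "w = (\<chi> i. d i / (\<Sum>j\<in>UNIV. d j))"
  shows "E_optimal Q w \<and>
    Psi_minf Q w = lambda_max (V_matrix Q w) \<and>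
    lambda_max (V_matrix Q w) = 2 * (\<Sum>i\<in>UNIV. d i) \<and>
    2 * (\<Sum>i\<in>UNIV. d i) = 4 * real CARD('s) \<and>
    ((\<forall>i. is_sink G i \<or> is_source G i) \<longrightarrow>
       eigenvector (V_matrix Q w) (\<chi> k. 1 / sqrt (real CARD('s))) (lambda_max (V_matrix Q w)))"
proof -
  obtain p n where "comparisons Q p n" using comparisons_of_system[OF assms(1)] .
  then interpret C: comparisons Q p n .
  have d: "d = C.d" using assms(2,4) by (auto simp: C.d_def C.degree_eq)
  have w: "w = C.w" unfolding assms(5) C.w_def d ..
  obtain e :: "real^'v" where e: "\<And>i. e $ i = 1 \<or> e $ i = - 1" "\<And>k. e $ n k = - e $ p k"
    using C.sign_of_bipartite assms(2,3) by blast
  note lm = C.lambda_max_w[OF e]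
  have "E_optimal Q w"
    unfolding E_optimal_def Psi_minf_def w lm
    using C.design_w C.feasible_w C.lambda_max_lower[OF e] by blast
  moreover have "eigenvector (V_matrix Q w) (\<chi> k. 1 / sqrt (real CARD('s))) (lambda_max (V_matrix Q w))"
    if sinks: "\<forall>i. is_sink G i \<or> is_source G i"
  proof -
    \<comment> \<open>Sign vectors of a bipartite graph are not unique; this one is 1 at every tail,
      so \<open>C.h e'\<close> is the all-ones vector.\<close>
    obtain e' :: "real^'v" where e': "\<And>i. e' $ i = 1 \<or> e' $ i = - 1"
      "\<And>k. e' $ p k = 1" "\<And>k. e' $ n k = - 1"
      using C.sign_of_sinks_and_sources sinks[unfolded assms(2)] by blast
    have "eigenvector (V_matrix Q w) (C.h e') (4 * real CARD('s))"
      unfolding w by (rule C.eigenvector_w) (use e' in auto)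
    moreover have "(\<chi> k. 1 / sqrt (real CARD('s))) = (1 / sqrt (real CARD('s))) *\<^sub>R C.h e'"
      by (simp add: C.h_def e' vec_eq_iff)
    ultimately show ?thesis
      unfolding w lm by (simp add: eigenvector_def matrix_vector_mult_scaleR)
  qed
  ultimately show ?thesis
    using lm by (simp add: Psi_minf_def w d C.sum_d)
qed

end
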